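(* Let $P_{XY}=P_XP_{Y|X}$ be a joint distribution with $P_{XY}\ll P_X\times P_Y$, let $\mathsf{M}\ge 1$ be an integer, and let $X(1),\dots,X(\mathsf{M})$ be i.i.d. with distribution $P_X$. Let $\mathsf{P}_Y(\cdot)=\frac{1}{\mathsf{M}}\sum_{k=1}^{\mathsf{M}}P_{Y|X}(\cdot\,|X(k))$ be the (random) induced output distribution. Then $$\mathbb{E}\big[\|\mathsf{P}_Y-P_Y\|\big]\le \frac{3}{2}\min_{0\le\rho\le\frac12}\ \mathsf{M}^{-\rho}\exp\!\Big(\rho\, I_{\frac{1}{1-\rho}}(X;Y)\Big),$$ where the expectation on the left is over the random codebook $(X(1),\dots,X(\mathsf{M}))$.
   Context: Alphabets are arbitrary measurable spaces; $P_{Y|X}$ is a channel (Markov kernel) and $P_Y$ is the $Y$-marginal of $P_{XY}=P_XP_{Y|X}$. $\log$ and $\exp$ are to base $\mathrm{e}$. Information density: $\imath_{X;Y}(x;y)=\log\frac{\mathrm{d}P_{XY}}{\mathrm{d}(P_X\times P_Y)}(x,y)$. Total variation distance (for $P\ll Q$): $\|P-Q\|=\mathbb{E}\big[[\tfrac{\mathrm{d}P}{\mathrm{d}Q}(\overline X)-1]_+\big]=\tfrac12\mathbb{E}\big[|\tfrac{\mathrm{d}P}{\mathrm{d}Q}(\overline X)-1|\big]$, where $\overline X\sim Q$ and $[x]_+=\max\{0,x\}$. $\alpha$-mutual information: for $\alpha>1$, $I_\alpha(X;Y)=\frac{\alpha}{\alpha-1}\log\mathbb{E}\Big[\big(\mathbb{E}[\exp(\alpha\,\imath_{X;Y}(X;\widetilde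 Y))\,|\,\widetilde Y]\big)^{1/\alpha}\Big]$ with $(X,\widetilde Y)\sim P_X\times P_Y$ (possibly $+\infty$). For $\rho=0$ the factor $\exp(\rho I_{1/(1-\rho)}(X;Y))$ equals $1$.
   Formalization: Added assumption: for P_X-almost every x, exp(ı(x;·)) is a density of P_{Y|X=x} with respect to P_Y; this is automatic when the output σ-algebra is countably generated, and on arbitrary alphabets the bound can fail without it. *)

theory Defs
  imports "HOL-Probability.Probability"
begin

section \<open>Extended logarithm, exponential and powers\<close>

text \<open>
  The information density may be \<open>-\<infinity>\<close> and the quantities inside the
  \<open>\<alpha>\<close>-mutual information may be \<open>\<infinity>\<close>, whereas the library's \<open>ln\<close> has \<open>ln 0 = 0\<close>.
\<close>

definition ln_ext :: "ennreal \<Rightarrow> ereal" where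
  "ln_ext x = (if x = 0 then -\<infinity> else if x = \<top> then \<infinity> else ereal (ln (enn2real x)))"

definition exp_ext :: "ereal \<Rightarrow> ennreal" where
  "exp_ext x = (case x of ereal r \<Rightarrow> ennreal (exp r) | PInfty \<Rightarrow> \<top> | MInfty \<Rightarrow> 0)"

text \<open>Used only for exponents \<open>a > 0\<close>, where \<open>0\<close> and \<open>\<infinity>\<close> are fixed points.\<close>

definition powr_ext :: "ennreal \<Rightarrow> real \<Rightarrow> ennreal" where
  "powr_ext x a = exp_ext (ereal a * ln_ext x)"

lemma exp_ext_simps [simp]:
  "exp_ext (ereal r) = ennreal (exp r)" "exp_ext \<infinity> = \<top>" "exp_ext (-\<infinity>) = 0"
  by (simp_all add: exp_ext_def flip: MInfty_eq_minfinity infinity_ereal_def)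

lemma exp_ext_ln_ext [simp]: "exp_ext (ln_ext x) = x"
proof (cases x rule: ennreal_cases)
  case (real r)
  then show ?thesis by (cases "r = 0") (auto simp: ln_ext_def)
qed (simp add: ln_ext_def)

lemma powr_ext_ennreal:
  assumes "0 \<le> r" "0 < a"
  shows "powr_ext (ennreal r) a = ennreal (r powr a)"
  using assms by (cases "r = 0") (auto simp: powr_ext_def ln_ext_def powr_def)

lemma powr_ext_top: "0 < a \<Longrightarrow> powr_ext \<top> a = \<top>"
  by (simp add: powr_ext_def ln_ext_def)

lemma borel_measurable_ln_ext [measurable]: "ln_ext \<in> borel_measurable borel"
  unfolding ln_ext_def[abs_def] by measurable

lemma borel_measurable_exp_ext [measurable]: "exp_ext \<in> borel_measurable borel"
proof -
  have "exp_ext = (\<lambda>x. if x = \<infinity> then \<top> else if x = -\<infinity> then 0 else ennreal (exp (real_of_ereal x)))"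
    by (rule ext, rename_tac x, case_tac x) auto
  also have "\<dots> \<in> borel_measurable borel" by measurable
  finally show ?thesis .
qed


section \<open>Channels, joint and output distributions\<close>

text \<open>
  Throughout, \<open>P\<close> is the input distribution \<open>P\<^sub>X\<close>, the sets of \<open>N\<close> are the
  \<open>\<sigma>\<close>-algebra of the output alphabet (its measure plays no role), and the channel
  \<open>P\<^bsub>Y|X\<^esub>\<close> is a Markov kernel \<open>K \<in> P \<rightarrow>\<^sub>M prob_algebra N\<close>.
\<close>

definition joint_dist :: "'a measure \<Rightarrow> 'b measure \<Rightarrow> ('a \<Rightarrow> 'b measure) \<Rightarrow> ('a \<times> 'b) measure" where
  "joint_dist P N K = P \<bind> (\<lambda>x. distr (K x) (P \<Otimes>\<^sub>M N) (Pair x))"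

definition output_dist :: "'a measure \<Rightarrow> 'b measure \<Rightarrow> ('a \<Rightarrow> 'b measure) \<Rightarrow> 'b measure" where
  "output_dist P N K = distr (joint_dist P N K) N snd"

definition induced_output ::
    "'b measure \<Rightarrow> ('a \<Rightarrow> 'b measure) \<Rightarrow> nat \<Rightarrow> (nat \<Rightarrow> 'a) \<Rightarrow> 'b measure" where
  "induced_output N K M c =
     measure_of (space N) (sets N) (\<lambda>B. ennreal (1 / real M) * (\<Sum>k = 1..M. emeasure (K (c k)) B))"

lemma joint_kernel_measurable:
  assumes K [measurable]: "K \<in> P \<rightarrow>\<^sub>M prob_algebra N"
  shows "(\<lambda>x. distr (K x) (P \<Otimes>\<^sub>M N) (Pair x)) \<in> P \<rightarrow>\<^sub>M prob_algebra (P \<Otimes>\<^sub>M N)"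
  by measurable

lemma kernel_sets:
  assumes "K \<in> P \<rightarrow>\<^sub>M prob_algebra N" "x \<in> space P"
  shows "sets (K x) = sets N" "prob_space (K x)"
  using measurable_space[OF assms] by (auto simp: space_prob_algebra)

lemma
  assumes "prob_space P" and K: "K \<in> P \<rightarrow>\<^sub>M prob_algebra N"
  shows prob_space_joint_dist: "prob_space (joint_dist P N K)"
    and sets_joint_dist: "sets (joint_dist P N K) = sets (P \<Otimes>\<^sub>M N)"
proof -
  interpret prob_space P by fact
  have P: "P \<in> space (prob_algebra P)"
    using \<open>prob_space P\<close> by (simp add: space_prob_algebra)
  show "prob_space (joint_dist P N K)" "sets (joint_dist P N K) = sets (P \<Otimes>\<^sub>M N)"
    unfolding joint_dist_def
    using prob_space_bind'[OF P joint_kernel_measurable[OF K]]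
      sets_bind'[OF P joint_kernel_measurable[OF K]] by auto
qed

lemma emeasure_joint_dist_Times:
  assumes "prob_space P" and K: "K \<in> P \<rightarrow>\<^sub>M prob_algebra N"
    and A [measurable]: "A \<in> sets P" and B [measurable]: "B \<in> sets N"
  shows "emeasure (joint_dist P N K) (A \<times> B) = (\<integral>\<^sup>+x\<in>A. emeasure (K x) B \<partial>P)"
proof -
  interpret prob_space P by fact
  have P: "P \<in> space (prob_algebra P)"
    using \<open>prob_space P\<close> by (simp add: space_prob_algebra)
  have "emeasure (joint_dist P N K) (A \<times> B)
      = (\<integral>\<^sup>+x. emeasure (distr (K x) (P \<Otimes>\<^sub>M N) (Pair x)) (A \<times> B) \<partial>P)"
    unfolding joint_dist_def
    by (rule emeasure_bind_prob_algebra[OF P joint_kernel_measurable[OF K]]) simp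
  also have "\<dots> = (\<integral>\<^sup>+x\<in>A. emeasure (K x) B \<partial>P)"
  proof (rule nn_integral_cong)
    fix x assume x: "x \<in> space P"
    note [measurable_cong] = kernel_sets(1)[OF K x]
    have sp: "space (K x) = space N" using kernel_sets(1)[OF K x] by (rule sets_eq_imp_space_eq)
    have "Pair x -` (A \<times> B) \<inter> space N = (if x \<in> A then B else {})"
      using sets.sets_into_space[OF B] by auto
    then show "emeasure (distr (K x) (P \<Otimes>\<^sub>M N) (Pair x)) (A \<times> B) = emeasure (K x) B * indicator A x"
      using x by (subst emeasure_distr) (auto simp: sp)
  qed
  finally show ?thesis .
qed

lemma output_dist_eq_bind:
  assumes "prob_space P" and K: "K \<in> P \<rightarrow>\<^sub>M prob_algebra N"
  shows "output_dist P N K = P \<bind> K"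
proof (rule measure_eqI)
  interpret prob_space P by fact
  have P: "P \<in> space (prob_algebra P)"
    using \<open>prob_space P\<close> by (simp add: space_prob_algebra)
  show "sets (output_dist P N K) = sets (P \<bind> K)"
    using sets_bind'[OF P K] by (simp add: output_dist_def)
  fix B assume "B \<in> sets (output_dist P N K)"
  then have B [measurable]: "B \<in> sets N" by (simp add: output_dist_def)
  note [measurable_cong] = sets_joint_dist[OF assms]
  have "snd -` B \<inter> space (joint_dist P N K) = space P \<times> B"
    using sets.sets_into_space[OF B] sets_eq_imp_space_eq[OF sets_joint_dist[OF assms]]
    by (auto simp: space_pair_measure)
  then have "emeasure (output_dist P N K) B = emeasure (joint_dist P N K) (space P \<times> B)"
    unfolding output_dist_def by (subst emeasure_distr) auto
  also have "\<dots> = (\<integral>\<^sup>+x. emeasure (K x) B \<partial>P)"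
    by (subst emeasure_joint_dist_Times[OF assms]) (auto intro!: nn_integral_cong)
  also have "\<dots> = emeasure (P \<bind> K) B"
    by (rule emeasure_bind_prob_algebra[OF P K B, symmetric])
  finally show "emeasure (output_dist P N K) B = emeasure (P \<bind> K) B" .
qed

lemma emeasure_induced_output:
  assumes K: "K \<in> P \<rightarrow>\<^sub>M prob_algebra N" and c: "\<And>k. k \<in> {1..M} \<Longrightarrow> c k \<in> space P"
    and B: "B \<in> sets N"
  shows "emeasure (induced_output N K M c) B
       = ennreal (1 / real M) * (\<Sum>k = 1..M. emeasure (K (c k)) B)"
proof (rule emeasure_measure_of[OF induced_output_def])
  show "countably_additive (sets (induced_output N K M c))
          (\<lambda>B. ennreal (1 / real M) * (\<Sum>k = 1..M. emeasure (K (c k)) B))"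
  proof (rule countably_additiveI)
    fix A :: "nat \<Rightarrow> 'b set"
    assume A: "range A \<subseteq> sets (induced_output N K M c)" "disjoint_family A"
    then have "range A \<subseteq> sets N" by (simp add: induced_output_def)
    then have "(\<Sum>i. emeasure (K (c k)) (A i)) = emeasure (K (c k)) (\<Union>i. A i)"
      if "k \<in> {1..M}" for k
      using kernel_sets(1)[OF K c[OF that]] A(2) by (intro suminf_emeasure) auto
    then show "(\<Sum>i. ennreal (1 / real M) * (\<Sum>k = 1..M. emeasure (K (c k)) (A i)))
        = ennreal (1 / real M) * (\<Sum>k = 1..M. emeasure (K (c k)) (\<Union>i. A i))"
      by (simp add: suminf_sum)
  qed
qed (use B sets.space_closed in \<open>auto simp: positive_def induced_output_def\<close>)


section \<open>Information measures\<close>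

text \<open>
  Note the argument order of the library's \<open>RN_deriv Q P\<close>, which is \<open>dP/dQ\<close>.
  As in the source, the total variation distance is meant for \<open>P \<lless> Q\<close>.
\<close>

definition tv_dist :: "'a measure \<Rightarrow> 'a measure \<Rightarrow> real" where
  "tv_dist P Q = (\<integral>x. max 0 (enn2real (RN_deriv Q P x) - 1) \<partial>Q)"

definition info_density ::
    "'a measure \<Rightarrow> 'b measure \<Rightarrow> ('a \<Rightarrow> 'b measure) \<Rightarrow> 'a \<times> 'b \<Rightarrow> ereal" where
  "info_density P N K z =
     ln_ext (RN_deriv (P \<Otimes>\<^sub>M output_dist P N K) (joint_dist P N K) z)"

text \<open>
  For \<open>\<alpha> > 1\<close>. The underlying probability space is \<open>P\<^sub>X \<times> P\<^sub>Y\<close>, with \<open>(X, Y)\<close> the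
  coordinate projections; the conditional expectation given the second coordinate is the one
  with respect to the \<open>\<sigma>\<close>-algebra generated by \<open>snd\<close>.
\<close>

definition alpha_mutual_info ::
    "real \<Rightarrow> 'a measure \<Rightarrow> 'b measure \<Rightarrow> ('a \<Rightarrow> 'b measure) \<Rightarrow> ereal" where
  "alpha_mutual_info \<alpha> P N K =
     (let Q = P \<Otimes>\<^sub>M output_dist P N K;
          F = vimage_algebra (space Q) snd N
      in ereal (\<alpha> / (\<alpha> - 1)) *
           ln_ext (\<integral>\<^sup>+z. powr_ext
             (nn_cond_exp Q F (\<lambda>z. exp_ext (ereal \<alpha> * info_density P N K z)) z) (1 / \<alpha>) \<partial>Q))"

text \<open>The factor \<open>exp (\<rho> I\<^bsub>1/(1-\<rho>)\<^esub>(X;Y))\<close>.\<close>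

definition exp_alpha_mutual_info ::
    "real \<Rightarrow> 'a measure \<Rightarrow> 'b measure \<Rightarrow> ('a \<Rightarrow> 'b measure) \<Rightarrow> ennreal" where
  "exp_alpha_mutual_info \<rho> P N K =
     (if \<rho> = 0 then 1 else exp_ext (ereal \<rho> * alpha_mutual_info (1 / (1 - \<rho>)) P N K))"


section \<open>Conditional densities\<close>

text \<open>
  The bound rests on the fact that \<open>exp (\<iota>(x; \<cdot>))\<close> is a density of \<open>P\<^bsub>Y|X=x\<^esub>\<close> with respect to \<open>P\<^sub>Y\<close> for
  \<open>P\<^sub>X\<close>-almost every \<open>x\<close>. Absolute continuity of the joint distribution alone gives, for each
  single event \<open>B\<close>, the identity of the two measures on \<open>B\<close> for almost every \<open>x\<close>, with an
  exceptional set that depends on \<open>B\<close>. When the \<open>\<sigma>\<close>-algebra of the output alphabet is countably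
  generated (for instance standard Borel or countable discrete) the exceptional sets can be merged,
  as the lemma below shows. On other alphabets this can fail, and the soft-covering bound
  with it: let \<open>X\<close> be uniform on \<open>[0,1]\<close> and let the channel be the law of independent
  Bernoulli(\<open>p\<close>) coins indexed by \<open>[0,1]\<close>, conditioned on coin number \<open>X\<close> being \<open>1\<close>; then
  \<open>P\<^bsub>XY\<^esub> = P\<^sub>X \<times> P\<^sub>Y\<close>, yet the expected distance tends to \<open>1\<close> as \<open>p \<rightarrow> 0\<close> for each fixed \<open>M\<close>.
\<close>

definition cond_density_exp_info ::
    "'a measure \<Rightarrow> 'b measure \<Rightarrow> ('a \<Rightarrow> 'b measure) \<Rightarrow> bool" where
  "cond_density_exp_info P N K \<longleftrightarrow>
     (AE x in P. K x = density (output_dist P N K) (\<lambda>y. exp_ext (info_density P N K (x, y))))"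

lemma cond_density_exp_info_countably_generated:
  assumes "prob_space P" and K: "K \<in> P \<rightarrow>\<^sub>M prob_algebra N"
    and ac: "absolutely_continuous (P \<Otimes>\<^sub>M output_dist P N K) (joint_dist P N K)"
    and G: "countable G" "G \<subseteq> Pow (space N)" "sets N = sigma_sets (space N) G"
  shows "cond_density_exp_info P N K"
proof -
  interpret P: prob_space P by fact
  let ?PY = "output_dist P N K" and ?J = "joint_dist P N K"
  let ?Q = "P \<Otimes>\<^sub>M ?PY"
  let ?f = "RN_deriv ?Q ?J"
  interpret J: prob_space ?J by (rule prob_space_joint_dist[OF assms(1,2)])
  have sets_PY [measurable_cong, simp]: "sets ?PY = sets N" by (simp add: output_dist_def)
  have space_PY [simp]: "space ?PY = space N" by (simp add: output_dist_def)
  note sets_J [measurable_cong] = sets_joint_dist[OF assms(1,2)]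
  interpret PY: prob_space ?PY unfolding output_dist_def by (rule J.prob_space_distr) measurable
  interpret Q: pair_prob_space P ?PY ..
  have sets_Q: "sets ?Q = sets (P \<Otimes>\<^sub>M N)" by (rule sets_pair_measure_cong) simp_all
  have f [measurable]: "?f \<in> borel_measurable (P \<Otimes>\<^sub>M N)"
    using borel_measurable_RN_deriv[of ?Q ?J] by (simp add: measurable_cong_sets[OF sets_Q])
  have dens: "density ?Q ?f = ?J"
    by (rule Q.density_RN_deriv[OF ac]) (simp add: sets_J sets_Q)
  have K' [measurable]: "K \<in> P \<rightarrow>\<^sub>M subprob_algebra N"
    using K by (rule measurable_prob_algebraD)
  have each: "AE x in P. emeasure (K x) B = (\<integral>\<^sup>+y\<in>B. ?f (x, y) \<partial>?PY)"
    if B [measurable]: "B \<in> sets N" for B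
  proof (rule P.density_unique)
    show "(\<lambda>x. emeasure (K x) B) \<in> borel_measurable P"
      by measurable
    show "(\<lambda>x. \<integral>\<^sup>+y\<in>B. ?f (x, y) \<partial>?PY) \<in> borel_measurable P"
      by measurable
    show "density P (\<lambda>x. emeasure (K x) B) = density P (\<lambda>x. \<integral>\<^sup>+y\<in>B. ?f (x, y) \<partial>?PY)"
    proof (rule measure_eqI)
      fix A assume "A \<in> sets (density P (\<lambda>x. emeasure (K x) B))"
      then have A [measurable]: "A \<in> sets P" by simp
      have "emeasure (density P (\<lambda>x. emeasure (K x) B)) A = emeasure ?J (A \<times> B)"
        by (subst emeasure_density) (auto simp: emeasure_joint_dist_Times[OF assms(1,2)])
      also have "\<dots> = emeasure (density ?Q ?f) (A \<times> B)" by (simp add: dens)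
      also have "\<dots> = (\<integral>\<^sup>+z. ?f z * indicator (A \<times> B) z \<partial>?Q)"
        by (rule emeasure_density) (auto simp: sets_Q)
      also have "\<dots> = (\<integral>\<^sup>+x. \<integral>\<^sup>+y. ?f (x, y) * indicator (A \<times> B) (x, y) \<partial>?PY \<partial>P)"
        by (rule PY.nn_integral_fst[symmetric]) measurable
      also have "\<dots> = (\<integral>\<^sup>+x. (\<integral>\<^sup>+y\<in>B. ?f (x, y) \<partial>?PY) * indicator A x \<partial>P)"
        by (intro nn_integral_cong) (auto simp: indicator_def intro!: nn_integral_cong)
      also have "\<dots> = emeasure (density P (\<lambda>x. \<integral>\<^sup>+y\<in>B. ?f (x, y) \<partial>?PY)) A"
        by (rule emeasure_density[symmetric]) measurable
      finally show "emeasure (density P (\<lambda>x. emeasure (K x) B)) A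
        = emeasure (density P (\<lambda>x. \<integral>\<^sup>+y\<in>B. ?f (x, y) \<partial>?PY)) A" .
    qed simp
  qed
  define E where "E = (\<lambda>H. \<Inter>H \<inter> space N) ` {H. finite H \<and> H \<subseteq> G}"
  have G_N: "G \<subseteq> sets N" using G(3) by auto
  have E_N: "E \<subseteq> sets N"
  proof
    fix B assume "B \<in> E"
    then obtain H where H: "B = \<Inter>H \<inter> space N" "finite H" "H \<subseteq> G" by (auto simp: E_def)
    show "B \<in> sets N"
    proof (cases "H = {}")
      case False
      then have "(\<Inter>h\<in>H. h) \<in> sets N" using H G_N by (intro sets.finite_INT) auto
      then show ?thesis using H by auto
    qed (use H in auto)
  qed
  have "countable E" unfolding E_def using countable_Collect_finite_subset[OF G(1)] by simp
  have space_E: "space N \<in> E" unfolding E_def by (rule image_eqI[of _ _ "{}"]) auto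
  have "Int_stable E"
  proof (rule Int_stableI)
    fix a b assume "a \<in> E" "b \<in> E"
    then obtain H1 H2 where "a = \<Inter>H1 \<inter> space N" "finite H1" "H1 \<subseteq> G"
      "b = \<Inter>H2 \<inter> space N" "finite H2" "H2 \<subseteq> G" by (auto simp: E_def)
    then show "a \<inter> b \<in> E"
      unfolding E_def by (intro image_eqI[of _ _ "H1 \<union> H2"]) auto
  qed
  have "G \<subseteq> E"
  proof
    fix B assume "B \<in> G"
    then show "B \<in> E" using G(2) unfolding E_def by (intro image_eqI[of _ _ "{B}"]) auto
  qed
  then have sets_E: "sets N = sigma_sets (space N) E"
    using G(3) E_N sets.sigma_sets_subset[of E N] sigma_sets_mono'[of G E "space N"] by auto
  have "AE x in P. \<forall>B\<in>E. emeasure (K x) B = (\<integral>\<^sup>+y\<in>B. ?f (x, y) \<partial>?PY)"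
    unfolding AE_ball_countable[OF \<open>countable E\<close>] using each E_N by auto
  then show ?thesis
    unfolding cond_density_exp_info_def info_density_def exp_ext_ln_ext
  proof (rule AE_mp[OF _ AE_I2], intro impI)
    fix x assume x: "x \<in> space P"
      and eq: "\<forall>B\<in>E. emeasure (K x) B = (\<integral>\<^sup>+y\<in>B. ?f (x, y) \<partial>?PY)"
    note sets_Kx [simp] = kernel_sets(1)[OF K x]
    interpret Kx: prob_space "K x" by (rule kernel_sets(2)[OF K x])
    have [measurable]: "(\<lambda>y. ?f (x, y)) \<in> borel_measurable ?PY" using x by measurable
    show "K x = density ?PY (\<lambda>y. ?f (x, y))"
    proof (rule measure_eqI_generator_eq[OF \<open>Int_stable E\<close>, where \<Omega> = "space N" and A = "\<lambda>_. space N"])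
      show "E \<subseteq> Pow (space N)" using E_N sets.space_closed by auto
      show "emeasure (K x) B = emeasure (density ?PY (\<lambda>y. ?f (x, y))) B" if "B \<in> E" for B
        using that E_N eq by (subst emeasure_density) auto
    qed (use sets_E space_E in \<open>auto simp: Kx.emeasure_eq_measure\<close>)
  qed
qed

end

theory Submission
  imports Defs
begin

text \<open>
  With \<open>f = dP\<^bsub>XY\<^esub>/d(P\<^sub>X \<times> P\<^sub>Y)\<close> and \<open>\<alpha> = 1/(1-\<rho>)\<close>, the factor \<open>exp (\<rho> I\<^sub>\<alpha>)\<close> is the \<open>P\<^sub>Y\<close>-mean of
  the \<open>L\<^sup>\<alpha>(P\<^sub>X)\<close>-norm of \<open>f(\<cdot>, y)\<close>. By Tonelli it suffices to bound, for fixed \<open>y\<close>, the expected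
  excess over \<open>1\<close> of the average of \<open>M\<close> independent copies of \<open>f(X, y)\<close>, a variable of mean \<open>1\<close>.
  Truncate at \<open>\<tau> = (M E[f\<^sup>\<alpha>])\<^bsup>1/\<alpha>\<^esup>\<close>: the part below \<open>\<tau>\<close> contributes at most half its standard
  deviation, which is at most \<open>\<tau>/(2M)\<close>, and the part above contributes at most its mean,
  which is at most \<open>\<tau>/M\<close>; finally \<open>\<tau>/M\<close> is \<open>M\<^bsup>-\<rho>\<^esup>\<close> times the norm. The minimum over \<open>\<rho>\<close> is
  attained because the bound is lower semicontinuous in \<open>\<rho>\<close>, by two applications of Fatou's lemma.
\<close>

section \<open>Powers of extended nonnegative reals\<close>

lemma powr_ext_one [simp]: "powr_ext x 1 = x"
  by (simp add: powr_ext_def flip: one_ereal_def)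

lemma powr_ext_mono:
  assumes "x \<le> y" "0 < a"
  shows "powr_ext x a \<le> powr_ext y a"
proof (cases y rule: ennreal_cases)
  case (real s)
  with assms(1) obtain r where "x = ennreal r" "0 \<le> r" by (cases x rule: ennreal_cases) (auto simp: top_unique)
  with real assms show ?thesis
    by (simp add: powr_ext_ennreal ennreal_leI powr_mono2)
qed (simp add: powr_ext_top assms(2))

lemma borel_measurable_powr_ext [measurable]: "(\<lambda>x. powr_ext x a) \<in> borel_measurable borel"
  unfolding powr_ext_def by measurable

text \<open>For positive exponents 0 and infinity are fixed points, so only finite nonzero bases
  call for continuity of the real power. Positivity of the limit matters:
  \<open>powr_ext 0 0\<close> is 1, which breaks continuity at exponent 0.\<close>

lemma tendsto_powr_ext:
  assumes a: "(a \<longlongrightarrow> l) F" and "0 < l"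
  shows "((\<lambda>n. powr_ext x (a n)) \<longlongrightarrow> powr_ext x l) F"
proof -
  have pos: "eventually (\<lambda>n. 0 < a n) F" using order_tendstoD(1)[OF a \<open>0 < l\<close>] .
  show ?thesis
  proof (cases x rule: ennreal_cases)
    case (real r)
    have "((\<lambda>n. ennreal (r powr a n)) \<longlongrightarrow> ennreal (r powr l)) F"
    proof (cases "r = 0")
      case False
      then show ?thesis by (intro tendsto_ennrealI tendsto_powr tendsto_const a) auto
    qed simp
    moreover have "eventually (\<lambda>n. powr_ext x (a n) = ennreal (r powr a n)) F"
      using pos by eventually_elim (simp add: real powr_ext_ennreal)
    ultimately show ?thesis
      using real \<open>0 < l\<close> by (simp add: powr_ext_ennreal tendsto_cong)
  next
    case top
    have "eventually (\<lambda>n. powr_ext x (a n) = powr_ext x l) F"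
      using pos by eventually_elim (simp add: top powr_ext_top \<open>0 < l\<close>)
    then show ?thesis by (rule tendsto_eventually)
  qed
qed

section \<open>Lower semicontinuity and attained minima\<close>

text \<open>Fatou's lemma yields only a lower bound for \<open>liminf u\<close>, so base and
  exponent cannot simply pass to the limit together. A constant base just below \<open>x\<close>
  suffices: it lies below \<open>u n\<close> eventually, and for a constant base the product is
  continuous in the exponent.\<close>

lemma liminf_scaled_powr_ext:
  fixes x :: ennreal and u :: "nat \<Rightarrow> ennreal" and m :: real
  assumes x: "x \<le> liminf u" and \<rho>: "\<rho> \<longlonglongrightarrow> l" and "l < 1" and "0 < m"
  shows "ennreal (m powr (- l)) * powr_ext x (1 - l)
       \<le> liminf (\<lambda>n. ennreal (m powr (- \<rho> n)) * powr_ext (u n) (1 - \<rho> n))"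
  unfolding le_Liminf_iff
proof (intro allI impI)
  fix C assume C: "C < ennreal (m powr (- l)) * powr_ext x (1 - l)"
  then obtain r where r: "C = ennreal r" "0 \<le> r" by (cases C rule: ennreal_cases) auto
  \<comment> \<open>solves \<open>m\<^bsup>-l\<^esup> c\<^bsup>1-l\<^esup> = r\<close>; any \<open>z\<close> with \<open>c < z < x\<close> then bounds \<open>u\<close> below eventually\<close>
  define c where "c = (r * m powr l) powr (1 / (1 - l))"
  have "0 \<le> c" by (simp add: c_def)
  have c: "m powr (- l) * c powr (1 - l) = r"
    using \<open>l < 1\<close> \<open>0 < m\<close> r by (simp add: c_def powr_powr powr_minus field_simps)
  have "ennreal c < x"
  proof (rule ccontr)
    assume "\<not> ennreal c < x"
    then have "powr_ext x (1 - l) \<le> powr_ext (ennreal c) (1 - l)"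
      using \<open>l < 1\<close> by (intro powr_ext_mono) auto
    then have "ennreal (m powr (- l)) * powr_ext x (1 - l)
        \<le> ennreal (m powr (- l)) * powr_ext (ennreal c) (1 - l)"
      by (rule mult_left_mono) simp
    also have "\<dots> = C"
      using \<open>l < 1\<close> c r \<open>0 \<le> c\<close> by (simp add: powr_ext_ennreal flip: ennreal_mult)
    finally show False using C by simp
  qed
  then obtain z where z: "ennreal c < z" "z < x" using dense by blast
  then obtain d where d: "z = ennreal d" "0 \<le> d" by (cases z rule: ennreal_cases) auto
  with z \<open>0 \<le> c\<close> have "c < d" by (simp add: ennreal_less_iff)
  then have "m powr (- l) * c powr (1 - l) < m powr (- l) * d powr (1 - l)"
    using \<open>0 < m\<close> \<open>l < 1\<close> \<open>0 \<le> c\<close> by (intro mult_strict_left_mono powr_less_mono2) auto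
  then have r_less: "r < m powr (- l) * d powr (1 - l)" by (simp add: c)
  \<comment> \<open>A positive base makes the real power continuous in its exponent.\<close>
  have "0 < d" using \<open>0 \<le> c\<close> \<open>c < d\<close> by simp
  have "(\<lambda>n. m powr (- \<rho> n) * d powr (1 - \<rho> n)) \<longlonglongrightarrow> m powr (- l) * d powr (1 - l)"
    using \<open>0 < m\<close> \<open>0 < d\<close> by (intro tendsto_intros \<rho>) auto
  then have "eventually (\<lambda>n. r < m powr (- \<rho> n) * d powr (1 - \<rho> n)) sequentially"
    using r_less by (rule order_tendstoD(1))
  moreover have "eventually (\<lambda>n. \<rho> n < 1) sequentially"
    using \<rho> \<open>l < 1\<close> by (rule order_tendstoD(2))
  moreover have "eventually (\<lambda>n. z < u n) sequentially"
    using x z(2) by (simp add: le_Liminf_iff)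
  ultimately show "eventually (\<lambda>n. C < ennreal (m powr (- \<rho> n)) * powr_ext (u n) (1 - \<rho> n)) sequentially"
  proof eventually_elim
    case (elim n)
    have "C < ennreal (m powr (- \<rho> n) * d powr (1 - \<rho> n))"
      using elim(1) r by (simp add: ennreal_less_iff)
    also have "\<dots> = ennreal (m powr (- \<rho> n)) * powr_ext z (1 - \<rho> n)"
      using elim(2) d by (simp add: powr_ext_ennreal ennreal_mult)
    also have "\<dots> \<le> ennreal (m powr (- \<rho> n)) * powr_ext (u n) (1 - \<rho> n)"
      using elim(2,3) by (intro mult_left_mono powr_ext_mono) auto
    finally show ?case .
  qed
qed

text \<open>Direct method: a minimizing sequence in a compact set has a convergent subsequence, and
  lower semicontinuity bounds the value at its limit by the infimum. The sequential form of
  semicontinuity is the one that Fatou's lemma provides.\<close>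

lemma compact_attains_Inf_of_liminf_le:
  fixes F :: "'a::first_countable_topology \<Rightarrow> 'b::{complete_linorder, linorder_topology, first_countable_topology}"
  assumes "compact S" "S \<noteq> {}"
    and lsc: "\<And>s l. (\<And>n. s n \<in> S) \<Longrightarrow> l \<in> S \<Longrightarrow> s \<longlonglongrightarrow> l \<Longrightarrow> F l \<le> liminf (\<lambda>n. F (s n))"
  shows "\<exists>l\<in>S. \<forall>x\<in>S. F l \<le> F x"
proof -
  obtain u where u: "\<And>n. u n \<in> F ` S" "u \<longlonglongrightarrow> Inf (F ` S)"
    using Inf_as_limit[of "F ` S"] \<open>S \<noteq> {}\<close> by auto
  then have "\<forall>n. \<exists>s\<in>S. u n = F s" by blast
  then obtain s where s: "\<And>n. s n \<in> S" "\<And>n. u n = F (s n)" by metis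
  obtain l r where l: "l \<in> S" "strict_mono r" "(s \<circ> r) \<longlonglongrightarrow> l"
    using compact_imp_seq_compact[OF \<open>compact S\<close>] s(1) unfolding seq_compact_def by blast
  have "F l \<le> liminf (\<lambda>n. F ((s \<circ> r) n))"
    using s(1) l by (intro lsc) (auto simp: o_def)
  also have "(\<lambda>n. F ((s \<circ> r) n)) = u \<circ> r" by (auto simp: s(2))
  also have "liminf (u \<circ> r) = Inf (F ` S)"
    using LIMSEQ_subseq_LIMSEQ[OF u(2) l(2)] by (intro lim_imp_Liminf) auto
  finally show ?thesis using l(1) by (meson INF_lower order_trans)
qed

section \<open>Moments of centred independent sums\<close>

text \<open>Expanding the square leaves only the diagonal, because independence turns each mixed
  mean into a product of two zero means.\<close>

lemma (in prob_space) expectation_square_sum_indep: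
  fixes \<xi> :: "'i \<Rightarrow> 'a \<Rightarrow> real"
  assumes indep: "indep_vars (\<lambda>_. borel) \<xi> I" and "finite I"
    and sq: "\<And>i. i \<in> I \<Longrightarrow> integrable M (\<lambda>\<omega>. (\<xi> i \<omega>)\<^sup>2)"
    and zero: "\<And>i. i \<in> I \<Longrightarrow> expectation (\<xi> i) = 0"
  shows "integrable M (\<lambda>\<omega>. (\<Sum>i\<in>I. \<xi> i \<omega>)\<^sup>2)"
    and "expectation (\<lambda>\<omega>. (\<Sum>i\<in>I. \<xi> i \<omega>)\<^sup>2) = (\<Sum>i\<in>I. expectation (\<lambda>\<omega>. (\<xi> i \<omega>)\<^sup>2))"
proof -
  have rv: "\<xi> i \<in> borel_measurable M" if "i \<in> I" for i
    using indep that by (simp add: indep_vars_def)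
  have int: "integrable M (\<xi> i)" if "i \<in> I" for i
    by (rule square_integrable_imp_integrable[OF rv[OF that] sq[OF that]])
  have cross: "integrable M (\<lambda>\<omega>. \<xi> i \<omega> * \<xi> j \<omega>) \<and> expectation (\<lambda>\<omega>. \<xi> i \<omega> * \<xi> j \<omega>) = 0"
    if ij: "i \<in> I" "j \<in> I" "i \<noteq> j" for i j
  proof -
    have ind: "indep_vars (\<lambda>_. borel) \<xi> {i, j}"
      using ij by (intro indep_vars_subset[OF indep]) auto
    show ?thesis
      using indep_vars_integrable[OF _ ind] indep_vars_lebesgue_integral[OF _ ind] ij int zero
      by auto
  qed
  have int2: "integrable M (\<lambda>\<omega>. \<xi> i \<omega> * \<xi> j \<omega>)" if "i \<in> I" "j \<in> I" for i j
    using cross[of i j] sq[of i] that by (cases "i = j") (auto simp: power2_eq_square)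
  have expand: "(\<Sum>i\<in>I. \<xi> i \<omega>)\<^sup>2 = (\<Sum>i\<in>I. \<Sum>j\<in>I. \<xi> i \<omega> * \<xi> j \<omega>)" for \<omega>
    by (simp add: power2_eq_square sum_product)
  show "integrable M (\<lambda>\<omega>. (\<Sum>i\<in>I. \<xi> i \<omega>)\<^sup>2)"
    unfolding expand by (intro Bochner_Integration.integrable_sum int2)
  have "expectation (\<lambda>\<omega>. (\<Sum>i\<in>I. \<xi> i \<omega>)\<^sup>2) = (\<Sum>i\<in>I. \<Sum>j\<in>I. expectation (\<lambda>\<omega>. \<xi> i \<omega> * \<xi> j \<omega>))"
    unfolding expand by (simp add: Bochner_Integration.integral_sum int2)
  also have "\<dots> = (\<Sum>i\<in>I. \<Sum>j\<in>I. if i = j then expectation (\<lambda>\<omega>. (\<xi> i \<omega>)\<^sup>2) else 0)"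
    using cross by (intro sum.cong refl) (auto simp: power2_eq_square)
  finally show "expectation (\<lambda>\<omega>. (\<Sum>i\<in>I. \<xi> i \<omega>)\<^sup>2) = (\<Sum>i\<in>I. expectation (\<lambda>\<omega>. (\<xi> i \<omega>)\<^sup>2))"
    using \<open>finite I\<close> by simp
qed

text \<open>The source of the factor one half: the positive part is (|S| + S)/2, and S has mean
  zero. That the mean of |S| is at most \<tau> follows from nonnegativity of the variance of
  |S|.\<close>

lemma (in prob_space) expectation_positive_part_le:
  fixes S :: "'a \<Rightarrow> real"
  assumes [measurable]: "S \<in> borel_measurable M" and sq: "integrable M (\<lambda>\<omega>. (S \<omega>)\<^sup>2)"
    and zero: "expectation S = 0" and \<tau>: "expectation (\<lambda>\<omega>. (S \<omega>)\<^sup>2) \<le> \<tau>\<^sup>2" "0 \<le> \<tau>"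
  shows "expectation (\<lambda>\<omega>. max 0 (S \<omega>)) \<le> \<tau> / 2"
proof -
  have int [simp]: "integrable M S" by (rule square_integrable_imp_integrable[OF assms(1) sq])
  have "variance (\<lambda>\<omega>. \<bar>S \<omega>\<bar>) = expectation (\<lambda>\<omega>. (S \<omega>)\<^sup>2) - (expectation (\<lambda>\<omega>. \<bar>S \<omega>\<bar>))\<^sup>2"
    using sq by (subst variance_eq) auto
  then have "(expectation (\<lambda>\<omega>. \<bar>S \<omega>\<bar>))\<^sup>2 \<le> \<tau>\<^sup>2"
    using \<tau>(1) variance_positive[of "\<lambda>\<omega>. \<bar>S \<omega>\<bar>"] by linarith
  then have "expectation (\<lambda>\<omega>. \<bar>S \<omega>\<bar>) \<le> \<tau>"
    using \<tau>(2) by (rule power2_le_imp_le)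
  moreover have "expectation (\<lambda>\<omega>. max 0 (S \<omega>)) = expectation (\<lambda>\<omega>. (\<bar>S \<omega>\<bar> + S \<omega>) / 2)"
    by (intro Bochner_Integration.integral_cong) auto
  ultimately show ?thesis using zero by simp
qed

section \<open>Truncation bound for the excess of an i.i.d. average\<close>

text \<open>For 1 \<le> \<alpha> \<le> 2 the \<alpha>-th moment controls both truncated parts: 2 -
  \<alpha> is nonnegative, which bounds the square below the threshold, and 1 - \<alpha> is
  nonpositive, which bounds the value above it. The contributions \<tau>/2 and \<tau> add up to the
  factor 3/2.\<close>

lemma (in prob_space) expectation_excess_iid_average_le:
  fixes \<phi> :: "'b \<Rightarrow> real" and X :: "nat \<Rightarrow> 'a \<Rightarrow> 'b"
  assumes n: "n \<ge> 1" and indep: "indep_vars (\<lambda>_. P) X {1..n}"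
    and ident: "\<And>k. k \<in> {1..n} \<Longrightarrow> distr M P (X k) = P"
    and \<phi> [measurable]: "\<phi> \<in> borel_measurable P" and nonneg: "\<And>x. 0 \<le> \<phi> x"
    and int: "integrable P \<phi>" and le1: "(\<integral>x. \<phi> x \<partial>P) \<le> 1"
    and \<alpha>: "1 \<le> \<alpha>" "\<alpha> \<le> 2" and int_\<alpha>: "integrable P (\<lambda>x. \<phi> x powr \<alpha>)"
    and A: "(\<integral>x. \<phi> x powr \<alpha> \<partial>P) = A" "0 < A"
  shows "integrable M (\<lambda>\<omega>. max 0 (1 / real n * (\<Sum>k=1..n. \<phi> (X k \<omega>)) - 1))"
    and "expectation (\<lambda>\<omega>. max 0 (1 / real n * (\<Sum>k=1..n. \<phi> (X k \<omega>)) - 1))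
       \<le> 3/2 * (real n powr (1 / \<alpha> - 1) * A powr (1 / \<alpha>))"
proof -
  have rv [measurable]: "X k \<in> M \<rightarrow>\<^sub>M P" if "k \<in> {1..n}" for k
    using indep that by (simp add: indep_vars_def)
  interpret P: prob_space P
  proof -
    have "prob_space (distr M P (X 1))" using n by (intro prob_space_distr rv) auto
    then show "prob_space P" using ident[of 1] n by simp
  qed
  have transfer: "integrable M (\<lambda>\<omega>. g (X k \<omega>)) \<longleftrightarrow> integrable P g"
    "expectation (\<lambda>\<omega>. g (X k \<omega>)) = (\<integral>x. g x \<partial>P)"
    if "k \<in> {1..n}" "g \<in> borel_measurable P" for k and g :: "'b \<Rightarrow> real"
    using integrable_distr_eq[OF rv[OF that(1)] that(2)] integral_distr[OF rv[OF that(1)] that(2)]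
      ident[OF that(1)] by auto
  \<comment> \<open>Chosen so that \<open>\<tau> powr \<alpha>\<close> is \<open>real n * A\<close>;
    then the moment bounds on the two parts, multiplied by n, collapse to exactly
    \<open>\<tau>\<^sup>2\<close> and \<tau>.\<close>
  define \<tau> where "\<tau> = (real n * A) powr (1 / \<alpha>)"
  have \<tau>: "0 < \<tau>" using n A by (simp add: \<tau>_def)
  have \<tau>_\<alpha>: "\<tau> powr \<alpha> = real n * A" using \<alpha> n A by (simp add: \<tau>_def powr_powr)
  define lo where "lo x = (if \<phi> x \<le> \<tau> then \<phi> x else 0)" for x
  define hi where "hi x = (if \<phi> x \<le> \<tau> then 0 else \<phi> x)" for x
  have [measurable]: "lo \<in> borel_measurable P" "hi \<in> borel_measurable P"
    unfolding lo_def hi_def by measurable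
  have split: "\<phi> x = lo x + hi x" "0 \<le> lo x" "0 \<le> hi x" "lo x \<le> \<phi> x" "hi x \<le> \<phi> x" for x
    using nonneg[of x] by (auto simp: lo_def hi_def)
  have int_lo: "integrable P lo" and int_hi: "integrable P hi"
    by (rule Bochner_Integration.integrable_bound[OF int], use split nonneg in auto)+
  have lo_sq: "(lo x)\<^sup>2 \<le> \<tau> powr (2 - \<alpha>) * \<phi> x powr \<alpha>" for x
  proof (cases "0 < \<phi> x \<and> \<phi> x \<le> \<tau>")
    case True
    then have "(lo x)\<^sup>2 = \<phi> x powr (2 - \<alpha>) * \<phi> x powr \<alpha>"
      by (simp add: lo_def flip: powr_add)
    also have "\<dots> \<le> \<tau> powr (2 - \<alpha>) * \<phi> x powr \<alpha>"
      using True \<alpha> by (intro mult_right_mono powr_mono2) auto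
    finally show ?thesis .
  qed (use nonneg[of x] in \<open>auto simp: lo_def\<close>)
  have hi_le: "hi x \<le> \<tau> powr (1 - \<alpha>) * \<phi> x powr \<alpha>" for x
  proof (cases "\<phi> x \<le> \<tau>")
    case False
    then have "hi x = \<phi> x powr (1 - \<alpha>) * \<phi> x powr \<alpha>"
      using \<tau> by (simp add: hi_def flip: powr_add)
    also have "\<dots> \<le> \<tau> powr (1 - \<alpha>) * \<phi> x powr \<alpha>"
      using False \<alpha> \<tau> by (intro mult_right_mono powr_mono2') auto
    finally show ?thesis .
  qed (auto simp: hi_def)
  have int_lo_sq: "integrable P (\<lambda>x. (lo x)\<^sup>2)"
    by (rule Bochner_Integration.integrable_bound[OF integrable_mult_right[OF int_\<alpha>, of "\<tau> powr (2 - \<alpha>)"]])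
       (use lo_sq in auto)
  have E_lo_sq: "real n * (\<integral>x. (lo x)\<^sup>2 \<partial>P) \<le> \<tau>\<^sup>2"
  proof -
    have "(\<integral>x. (lo x)\<^sup>2 \<partial>P) \<le> (\<integral>x. \<tau> powr (2 - \<alpha>) * \<phi> x powr \<alpha> \<partial>P)"
      by (intro integral_mono int_lo_sq integrable_mult_right int_\<alpha> lo_sq)
    then have "real n * (\<integral>x. (lo x)\<^sup>2 \<partial>P) \<le> real n * (\<tau> powr (2 - \<alpha>) * A)"
      by (intro mult_left_mono) (simp_all add: A)
    also have "\<dots> = \<tau> powr (2 - \<alpha>) * \<tau> powr \<alpha>" by (simp add: \<tau>_\<alpha>)
    also have "\<dots> = \<tau>\<^sup>2" using \<tau> by (simp flip: powr_add)
    finally show ?thesis .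
  qed
  have E_hi: "real n * (\<integral>x. hi x \<partial>P) \<le> \<tau>"
  proof -
    have "(\<integral>x. hi x \<partial>P) \<le> (\<integral>x. \<tau> powr (1 - \<alpha>) * \<phi> x powr \<alpha> \<partial>P)"
      by (intro integral_mono int_hi integrable_mult_right int_\<alpha> hi_le)
    then have "real n * (\<integral>x. hi x \<partial>P) \<le> real n * (\<tau> powr (1 - \<alpha>) * A)"
      by (intro mult_left_mono) (simp_all add: A)
    also have "\<dots> = \<tau> powr (1 - \<alpha>) * \<tau> powr \<alpha>" by (simp add: \<tau>_\<alpha>)
    also have "\<dots> = \<tau>" using \<tau> by (simp flip: powr_add)
    finally show ?thesis .
  qed
  \<comment> \<open>Dropping the large values can only lower the mean, so \<mu> is at most 1. This
    one-sided bound is what is set against the subtracted 1 in \<open>pointwise\<close>.\<close>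
  define \<mu> where "\<mu> = (\<integral>x. lo x \<partial>P)"
  have \<mu>: "\<mu> \<le> 1"
    using le1 integral_mono[OF int_lo int split(4)] by (simp add: \<mu>_def)
  define \<xi> where "\<xi> k \<omega> = lo (X k \<omega>) - \<mu>" for k \<omega>
  define S where "S \<omega> = (\<Sum>k=1..n. \<xi> k \<omega>)" for \<omega>
  have int_c_sq: "integrable P (\<lambda>x. (lo x - \<mu>)\<^sup>2)"
    using int_lo int_lo_sq by (auto simp: power2_diff)
  \<comment> \<open>Centring does not increase the second moment.\<close>
  have var: "(\<integral>x. (lo x - \<mu>)\<^sup>2 \<partial>P) \<le> (\<integral>x. (lo x)\<^sup>2 \<partial>P)"
    using P.variance_eq[OF int_lo int_lo_sq] by (simp add: \<mu>_def)
  have meas_c: "(\<lambda>x. lo x - \<mu>) \<in> borel_measurable P" "(\<lambda>x. (lo x - \<mu>)\<^sup>2) \<in> borel_measurable P"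
    by measurable
  have int_c: "integrable P (\<lambda>x. lo x - \<mu>)" using int_lo by simp
  have \<xi>_indep: "indep_vars (\<lambda>_. borel) \<xi> {1..n}"
    unfolding \<xi>_def[abs_def] by (rule indep_vars_compose2[OF indep]) simp
  have \<xi>_int: "integrable M (\<xi> k)" if "k \<in> {1..n}" for k
    unfolding \<xi>_def[abs_def] transfer(1)[OF that meas_c(1)] by (rule int_c)
  have \<xi>_zero: "expectation (\<xi> k) = 0" if "k \<in> {1..n}" for k
    unfolding \<xi>_def[abs_def] transfer(2)[OF that meas_c(1)] using int_lo by (simp add: \<mu>_def P.prob_space)
  have \<xi>_sq: "integrable M (\<lambda>\<omega>. (\<xi> k \<omega>)\<^sup>2)" if "k \<in> {1..n}" for k
    unfolding \<xi>_def transfer(1)[OF that meas_c(2)] by (rule int_c_sq)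
  note sq = expectation_square_sum_indep[OF \<xi>_indep finite_atLeastAtMost \<xi>_sq \<xi>_zero]
  have "expectation (\<lambda>\<omega>. (S \<omega>)\<^sup>2) = (\<Sum>k=1..n. expectation (\<lambda>\<omega>. (\<xi> k \<omega>)\<^sup>2))"
    unfolding S_def by (rule sq(2))
  also have "\<dots> = real n * (\<integral>x. (lo x - \<mu>)\<^sup>2 \<partial>P)"
    by (simp add: \<xi>_def transfer(2)[OF _ meas_c(2)])
  also have "\<dots> \<le> real n * (\<integral>x. (lo x)\<^sup>2 \<partial>P)"
    by (intro mult_left_mono var) simp
  finally have S_sq: "expectation (\<lambda>\<omega>. (S \<omega>)\<^sup>2) \<le> \<tau>\<^sup>2" using E_lo_sq by linarith
  have S_int: "integrable M S"
    unfolding S_def[abs_def] by (intro Bochner_Integration.integrable_sum \<xi>_int)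
  have "expectation S = 0"
    unfolding S_def[abs_def] by (subst Bochner_Integration.integral_sum) (auto simp: \<xi>_int \<xi>_zero)
  then have E_S: "expectation (\<lambda>\<omega>. max 0 (S \<omega>)) \<le> \<tau> / 2"
    using S_int sq(1)[folded S_def] S_sq \<tau> by (intro expectation_positive_part_le) auto
  have hi_int: "integrable M (\<lambda>\<omega>. \<Sum>k=1..n. hi (X k \<omega>))"
    by (intro Bochner_Integration.integrable_sum) (simp add: transfer int_hi)
  have E_hi': "expectation (\<lambda>\<omega>. \<Sum>k=1..n. hi (X k \<omega>)) \<le> \<tau>"
    using E_hi by (subst Bochner_Integration.integral_sum) (auto simp: transfer int_hi)
  have bound_int: "integrable M (\<lambda>\<omega>. (max 0 (S \<omega>) + (\<Sum>k=1..n. hi (X k \<omega>))) / real n)"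
    using S_int hi_int by auto
  have pointwise: "max 0 (1 / real n * (\<Sum>k=1..n. \<phi> (X k \<omega>)) - 1)
      \<le> (max 0 (S \<omega>) + (\<Sum>k=1..n. hi (X k \<omega>))) / real n" for \<omega>
  proof -
    have "(\<Sum>k=1..n. \<phi> (X k \<omega>)) = S \<omega> + (\<Sum>k=1..n. hi (X k \<omega>)) + real n * \<mu>"
      by (simp add: S_def \<xi>_def split(1) sum.distrib sum_subtractf)
    also have "\<dots> \<le> max 0 (S \<omega>) + (\<Sum>k=1..n. hi (X k \<omega>)) + real n"
      using \<mu> mult_left_mono[OF \<mu>, of "real n"] by (intro add_mono) auto
    finally have "(\<Sum>k=1..n. \<phi> (X k \<omega>)) \<le> \<dots>" .
    then have "(\<Sum>k=1..n. \<phi> (X k \<omega>)) / real n - 1 \<le> (\<dots> / real n) - 1"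
      by (intro diff_right_mono divide_right_mono) auto
    then have "1 / real n * (\<Sum>k=1..n. \<phi> (X k \<omega>)) - 1
        \<le> (max 0 (S \<omega>) + (\<Sum>k=1..n. hi (X k \<omega>))) / real n"
      using n by (simp add: add_divide_distrib)
    moreover have "0 \<le> (max 0 (S \<omega>) + (\<Sum>k=1..n. hi (X k \<omega>))) / real n"
      by (intro divide_nonneg_nonneg add_nonneg_nonneg sum_nonneg split(3)) auto
    ultimately show ?thesis by simp
  qed
  show goal_int: "integrable M (\<lambda>\<omega>. max 0 (1 / real n * (\<Sum>k=1..n. \<phi> (X k \<omega>)) - 1))"
    by (intro integrable_max Bochner_Integration.integrable_diff integrable_mult_right
        Bochner_Integration.integrable_sum) (simp_all add: transfer int)
  have "expectation (\<lambda>\<omega>. max 0 (1 / real n * (\<Sum>k=1..n. \<phi> (X k \<omega>)) - 1))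
      \<le> expectation (\<lambda>\<omega>. (max 0 (S \<omega>) + (\<Sum>k=1..n. hi (X k \<omega>))) / real n)"
    by (intro integral_mono goal_int bound_int pointwise)
  also have "\<dots> = (expectation (\<lambda>\<omega>. max 0 (S \<omega>)) + expectation (\<lambda>\<omega>. \<Sum>k=1..n. hi (X k \<omega>))) / real n"
    using S_int hi_int by simp
  also have "\<dots> \<le> (\<tau> / 2 + \<tau>) / real n"
    by (intro divide_right_mono add_mono E_S E_hi') simp
  also have "\<dots> = 3/2 * (\<tau> / real n)" by (simp add: field_simps)
  also have "\<tau> / real n = real n powr (1 / \<alpha> - 1) * A powr (1 / \<alpha>)"
    using n A by (simp add: \<tau>_def powr_mult powr_diff)
  finally show "expectation (\<lambda>\<omega>. max 0 (1 / real n * (\<Sum>k=1..n. \<phi> (X k \<omega>)) - 1))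
       \<le> 3/2 * (real n powr (1 / \<alpha> - 1) * A powr (1 / \<alpha>))" .
qed

text \<open>Subtraction on \<open>ennreal\<close> stops at 0, so the integrand is the positive part
  of the excess. If the \<alpha>-th moment is finite, mean one makes \<phi> finite almost
  everywhere, and the real-valued estimate applies to its \<open>enn2real\<close> version.\<close>

lemma (in prob_space) nn_integral_excess_iid_average_le:
  fixes \<phi> :: "'b \<Rightarrow> ennreal" and X :: "nat \<Rightarrow> 'a \<Rightarrow> 'b"
  assumes n: "n \<ge> 1" and indep: "indep_vars (\<lambda>_. P) X {1..n}"
    and ident: "\<And>k. k \<in> {1..n} \<Longrightarrow> distr M P (X k) = P"
    and \<phi> [measurable]: "\<phi> \<in> borel_measurable P" and one: "(\<integral>\<^sup>+x. \<phi> x \<partial>P) = 1"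
    and \<rho>: "0 \<le> \<rho>" "\<rho> \<le> 1/2"
  shows "(\<integral>\<^sup>+\<omega>. ennreal (1 / real n) * (\<Sum>k=1..n. \<phi> (X k \<omega>)) - 1 \<partial>M)
       \<le> ennreal (3/2) * (ennreal (real n powr (- \<rho>))
            * powr_ext (\<integral>\<^sup>+x. powr_ext (\<phi> x) (1 / (1 - \<rho>)) \<partial>P) (1 - \<rho>))"
proof -
  define \<alpha> where "\<alpha> = 1 / (1 - \<rho>)"
  have \<alpha>: "1 \<le> \<alpha>" "\<alpha> \<le> 2" "1 / \<alpha> = 1 - \<rho>" "1 / \<alpha> - 1 = - \<rho>"
    using \<rho> by (auto simp: \<alpha>_def field_simps)
  have rv [measurable]: "X k \<in> M \<rightarrow>\<^sub>M P" if "k \<in> {1..n}" for k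
    using indep that by (simp add: indep_vars_def)
  show ?thesis
  proof (cases "(\<integral>\<^sup>+x. powr_ext (\<phi> x) \<alpha> \<partial>P)" rule: ennreal_cases)
    \<comment> \<open>Since n \<ge> 1, the factor \<open>real n powr (- \<rho>)\<close> is positive
      and the right side is infinite.\<close>
    case top
    then show ?thesis
      using n \<rho> by (simp add: powr_ext_top ennreal_mult_top flip: \<alpha>_def)
  next
    case (real A)
    define g where "g x = enn2real (\<phi> x)" for x
    have [measurable]: "g \<in> borel_measurable P" unfolding g_def by measurable
    have g_nonneg: "0 \<le> g x" for x by (simp add: g_def)
    have fin: "AE x in P. \<phi> x \<noteq> \<top>"
      using nn_integral_PInf_AE[OF \<phi>] one by simp
    then have \<phi>_g: "AE x in P. \<phi> x = ennreal (g x)"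
      by eventually_elim (simp add: g_def less_top)
    have g_one: "(\<integral>\<^sup>+x. ennreal (g x) \<partial>P) = ennreal 1"
      using nn_integral_cong_AE[OF \<phi>_g] one by simp
    have "AE x in P. powr_ext (\<phi> x) \<alpha> = ennreal (g x powr \<alpha>)"
      using \<phi>_g by eventually_elim (use \<alpha> g_nonneg in \<open>simp add: powr_ext_ennreal\<close>)
    then have g_A: "(\<integral>\<^sup>+x. ennreal (g x powr \<alpha>) \<partial>P) = ennreal A"
      using real nn_integral_cong_AE by fastforce
    have int: "integrable P g" "(\<integral>x. g x \<partial>P) = 1"
      using nn_integral_eq_integrable[THEN iffD1, OF _ _ _ g_one] g_nonneg by auto
    have int_\<alpha>: "integrable P (\<lambda>x. g x powr \<alpha>)" "(\<integral>x. g x powr \<alpha> \<partial>P) = A"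
      using nn_integral_eq_integrable[THEN iffD1, OF _ _ _ g_A] real by auto
    \<comment> \<open>A vanishing moment would force \<phi> to vanish almost everywhere, against
      mean one; A must be positive for a positive threshold in the truncation.\<close>
    have "A \<noteq> 0"
    proof
      assume "A = 0"
      then have "AE x in P. g x powr \<alpha> = 0"
        using integral_nonneg_eq_0_iff_AE[OF int_\<alpha>(1)] int_\<alpha>(2) by simp
      then have "AE x in P. g x = 0" by eventually_elim simp
      then have "(\<integral>x. g x \<partial>P) = 0" by (rule integral_eq_zero_AE)
      then show False using int(2) by simp
    qed
    then have "0 < A" using real by simp
    note * = expectation_excess_iid_average_le[OF n indep ident _ g_nonneg int(1) _ \<alpha>(1,2) int_\<alpha> \<open>0 < A\<close>]
    have "AE \<omega> in M. \<forall>k\<in>{1..n}. \<phi> (X k \<omega>) = ennreal (g (X k \<omega>))"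
    proof (rule AE_finite_allI)
      fix k assume "k \<in> {1..n}"
      then show "AE \<omega> in M. \<phi> (X k \<omega>) = ennreal (g (X k \<omega>))"
        using \<phi>_g by (intro AE_distrD[OF rv]) (simp, subst ident)
    qed simp
    then have "AE \<omega> in M. ennreal (1 / real n) * (\<Sum>k=1..n. \<phi> (X k \<omega>)) - 1
        = ennreal (max 0 (1 / real n * (\<Sum>k=1..n. g (X k \<omega>)) - 1))"
    proof eventually_elim
      case (elim \<omega>)
      have "ennreal (1 / real n) * (\<Sum>k=1..n. \<phi> (X k \<omega>)) = ennreal (1 / real n * (\<Sum>k=1..n. g (X k \<omega>)))"
        using elim g_nonneg by (simp add: sum_nonneg flip: ennreal_mult)
      then show ?case
        by (simp only: ennreal_minus[OF zero_le_one] flip: ennreal_1) (auto simp: max_def ennreal_neg)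
    qed
    then have "(\<integral>\<^sup>+\<omega>. ennreal (1 / real n) * (\<Sum>k=1..n. \<phi> (X k \<omega>)) - 1 \<partial>M)
        = (\<integral>\<^sup>+\<omega>. ennreal (max 0 (1 / real n * (\<Sum>k=1..n. g (X k \<omega>)) - 1)) \<partial>M)"
      by (rule nn_integral_cong_AE)
    also have "\<dots> = ennreal (expectation (\<lambda>\<omega>. max 0 (1 / real n * (\<Sum>k=1..n. g (X k \<omega>)) - 1)))"
      using int(2) by (intro nn_integral_eq_integral *) auto
    also have "\<dots> \<le> ennreal (3/2 * (real n powr (1 / \<alpha> - 1) * A powr (1 / \<alpha>)))"
      using int(2) by (intro ennreal_leI *) auto
    also have "\<dots> = ennreal (3/2) * (ennreal (real n powr (- \<rho>)) * powr_ext (ennreal A) (1 - \<rho>))"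
      using real \<rho> unfolding \<alpha>(3,4) by (simp add: powr_ext_ennreal flip: ennreal_mult)
    finally show ?thesis using real by (simp flip: \<alpha>_def)
  qed
qed

section \<open>Total variation as a nonnegative integral\<close>

text \<open>Two default values can only decrease the left side: the Bochner integral is 0 for a
  non-integrable function, and \<open>enn2real\<close> sends infinity to 0.\<close>

lemma ennreal_tv_dist_le:
  "ennreal (tv_dist P Q) \<le> (\<integral>\<^sup>+x. RN_deriv Q P x - 1 \<partial>Q)"
proof -
  have "ennreal (tv_dist P Q) \<le> (\<integral>\<^sup>+x. ennreal (max 0 (enn2real (RN_deriv Q P x) - 1)) \<partial>Q)"
  proof (cases "integrable Q (\<lambda>x. max 0 (enn2real (RN_deriv Q P x) - 1))")
    case True
    then show ?thesis unfolding tv_dist_def by (subst nn_integral_eq_integral) auto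
  qed (simp add: tv_dist_def not_integrable_integral_eq)
  also have "\<dots> \<le> (\<integral>\<^sup>+x. RN_deriv Q P x - 1 \<partial>Q)"
  proof (rule nn_integral_mono)
    fix x
    show "ennreal (max 0 (enn2real (RN_deriv Q P x) - 1)) \<le> RN_deriv Q P x - 1"
    proof (cases "RN_deriv Q P x" rule: ennreal_cases)
      case (real r)
      then show ?thesis
        by (simp only: ennreal_minus[OF zero_le_one] flip: ennreal_1) (auto simp: max_def ennreal_neg)
    qed simp
  qed
  finally show ?thesis .
qed

section \<open>Densities under absolute continuity of the joint distribution\<close>

locale abs_cont_channel = P: prob_space P
  for P :: "'a measure" and N :: "'b measure" and K :: "'a \<Rightarrow> 'b measure" +
  assumes K: "K \<in> P \<rightarrow>\<^sub>M prob_algebra N"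
    and ac: "absolutely_continuous (P \<Otimes>\<^sub>M output_dist P N K) (joint_dist P N K)"
begin

abbreviation "PY \<equiv> output_dist P N K"
abbreviation "Q \<equiv> P \<Otimes>\<^sub>M PY"
abbreviation "f \<equiv> RN_deriv Q (joint_dist P N K)"

sublocale J: prob_space "joint_dist P N K"
  by (rule prob_space_joint_dist[OF P.prob_space_axioms K])

lemma sets_PY [measurable_cong, simp]: "sets PY = sets N"
  by (simp add: output_dist_def)

lemma space_PY [simp]: "space PY = space N"
  by (simp add: output_dist_def)

lemma sets_J [measurable_cong]: "sets (joint_dist P N K) = sets (P \<Otimes>\<^sub>M N)"
  by (rule sets_joint_dist[OF P.prob_space_axioms K])

sublocale PY: prob_space PY
  unfolding output_dist_def by (rule J.prob_space_distr) measurable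

sublocale Q: pair_prob_space P PY ..

lemma sets_Q: "sets Q = sets (P \<Otimes>\<^sub>M N)"
  by (rule sets_pair_measure_cong) simp_all

lemma f_measurable [measurable]: "f \<in> borel_measurable (P \<Otimes>\<^sub>M N)"
  using borel_measurable_RN_deriv[of Q "joint_dist P N K"] by (simp add: measurable_cong_sets[OF sets_Q])

lemma density_f: "density Q f = joint_dist P N K"
  by (rule Q.density_RN_deriv[OF ac]) (simp add: sets_J sets_Q)

text \<open>Integrating \<open>f\<close> over \<open>space P \<times> B\<close> shows that its
  x-integral is a density of the output distribution with respect to itself, and densities are
  unique almost everywhere. This supplies the mean one required by the i.i.d. bound.\<close>

lemma AE_nn_integral_f_eq_1: "AE y in PY. (\<integral>\<^sup>+x. f (x, y) \<partial>P) = 1"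
proof (rule PY.density_unique)
  show "density PY (\<lambda>y. \<integral>\<^sup>+x. f (x, y) \<partial>P) = density PY (\<lambda>y. 1)"
  proof (rule measure_eqI)
    fix B assume "B \<in> sets (density PY (\<lambda>y. \<integral>\<^sup>+x. f (x, y) \<partial>P))"
    then have B [measurable]: "B \<in> sets N" by simp
    have "emeasure (density PY (\<lambda>y. \<integral>\<^sup>+x. f (x, y) \<partial>P)) B = (\<integral>\<^sup>+y. (\<integral>\<^sup>+x. f (x, y) \<partial>P) * indicator B y \<partial>PY)"
      by (rule emeasure_density) measurable
    also have "\<dots> = (\<integral>\<^sup>+y. \<integral>\<^sup>+x. f (x, y) * indicator (space P \<times> B) (x, y) \<partial>P \<partial>PY)"
      by (intro nn_integral_cong, subst nn_integral_multc[symmetric])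
        (auto simp: indicator_def intro!: nn_integral_cong)
    also have "\<dots> = (\<integral>\<^sup>+z. f z * indicator (space P \<times> B) z \<partial>Q)"
      by (rule Q.nn_integral_snd[of "\<lambda>z. f z * indicator (space P \<times> B) z", simplified]) measurable
    also have "\<dots> = emeasure (density Q f) (space P \<times> B)"
      by (rule emeasure_density[symmetric]) (auto simp: sets_Q)
    also have "\<dots> = emeasure (joint_dist P N K) (space P \<times> B)" by (simp add: density_f)
    also have "space P \<times> B = snd -` B \<inter> space (joint_dist P N K)"
      using sets.sets_into_space[OF B] sets_eq_imp_space_eq[OF sets_J]
      by (auto simp: space_pair_measure)
    also have "emeasure (joint_dist P N K) \<dots> = emeasure PY B"
      unfolding output_dist_def by (rule emeasure_distr[symmetric]) measurable
    finally show "emeasure (density PY (\<lambda>y. \<integral>\<^sup>+x. f (x, y) \<partial>P)) B = emeasure (density PY (\<lambda>y. 1)) B"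
      by (simp add: density_1)
  qed simp
qed measurable

section \<open>The alpha-mutual information as a mixed norm\<close>

text \<open>The mixed norm of \<open>f\<close>: an L^1 norm in y of L^(1/(1-\<rho>)) norms in x.
  Iterated integrals, with neither a conditional expectation nor a separate case at 0, are a form to
  which Fatou's lemma applies directly.\<close>

definition mean_norm :: "real \<Rightarrow> ennreal" where
  "mean_norm \<rho> = (\<integral>\<^sup>+y. powr_ext (\<integral>\<^sup>+x. powr_ext (f (x, y)) (1 / (1 - \<rho>)) \<partial>P) (1 - \<rho>) \<partial>PY)"

text \<open>Under a product measure the coordinates are independent, so conditioning on the second
  integrates out the first. The candidate is tested on the events of the generated algebra, all of
  which are preimages under \<open>snd\<close>.\<close>

lemma AE_nn_cond_exp_snd:
  assumes [measurable]: "g \<in> borel_measurable (P \<Otimes>\<^sub>M N)"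
  shows "AE z in Q. (\<integral>\<^sup>+x. g (x, snd z) \<partial>P) = nn_cond_exp Q (vimage_algebra (space Q) snd N) g z"
proof -
  let ?F = "vimage_algebra (space Q) snd N"
  have snd_F: "snd \<in> ?F \<rightarrow>\<^sub>M N"
    by (rule measurable_vimage_algebra1) (auto simp: space_pair_measure)
  have "sets ?F \<subseteq> sets Q"
    by (rule sets_image_in_sets) (simp_all, measurable)
  then interpret F: finite_measure_subalgebra Q ?F
    by unfold_locales (simp add: subalgebra_def)
  show ?thesis
  proof (rule F.nn_cond_exp_charact)
    show "g \<in> borel_measurable Q" by measurable
    show "(\<lambda>z. \<integral>\<^sup>+x. g (x, snd z) \<partial>P) \<in> borel_measurable ?F"
      by (rule measurable_compose[OF snd_F]) measurable
    fix A assume "A \<in> sets ?F"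
    then obtain B where B [measurable]: "B \<in> sets N" and A: "A = snd -` B \<inter> space Q"
      by (subst (asm) sets_vimage_algebra2) (auto simp: space_pair_measure)
    have ind: "indicator A (x, y) = (indicator B y :: ennreal)" if "x \<in> space P" "y \<in> space N" for x y
      using that by (auto simp: A space_pair_measure indicator_def)
    have [measurable]: "A \<in> sets (P \<Otimes>\<^sub>M N)"
      using \<open>sets ?F \<subseteq> sets Q\<close> \<open>A \<in> sets ?F\<close> sets_Q by auto
    have "(\<integral>\<^sup>+z\<in>A. g z \<partial>Q) = (\<integral>\<^sup>+y. \<integral>\<^sup>+x. g (x, y) * indicator A (x, y) \<partial>P \<partial>PY)"
      by (rule Q.nn_integral_snd[of "\<lambda>z. g z * indicator A z", simplified, symmetric]) measurable
    also have "\<dots> = (\<integral>\<^sup>+y. (\<integral>\<^sup>+x. g (x, y) \<partial>P) * indicator B y \<partial>PY)"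
      by (intro nn_integral_cong, subst nn_integral_multc[symmetric])
        (auto simp: ind intro!: nn_integral_cong)
    \<comment> \<open>The integral over \<open>x'\<close> is inserted at no cost because
      \<open>P\<close> has mass 1; it allows the iterated integral to be read as one over
      \<open>Q\<close>.\<close>
    also have "\<dots> = (\<integral>\<^sup>+y. \<integral>\<^sup>+x'. (\<integral>\<^sup>+x. g (x, y) \<partial>P) * indicator A (x', y) \<partial>P \<partial>PY)"
      by (intro nn_integral_cong) (simp add: ind P.emeasure_space_1 cong: nn_integral_cong)
    also have "\<dots> = (\<integral>\<^sup>+z\<in>A. (\<integral>\<^sup>+x. g (x, snd z) \<partial>P) \<partial>Q)"
      by (subst Q.nn_integral_snd[of "\<lambda>z. (\<integral>\<^sup>+x. g (x, snd z) \<partial>P) * indicator A z", simplified, symmetric]) auto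
    finally show "(\<integral>\<^sup>+z\<in>A. g z \<partial>Q) = (\<integral>\<^sup>+z\<in>A. (\<integral>\<^sup>+x. g (x, snd z) \<partial>P) \<partial>Q)" .
  qed
qed

text \<open>With \<alpha> = 1/(1-\<rho>) the prefactor \<alpha>/(\<alpha>-1) equals 1/\<rho> and
  cancels \<rho>, after which the exponential undoes the logarithm, also at 0 and infinity. At
  \<rho> = 0 both sides are 1 because \<open>f\<close> has mean one in x.\<close>

lemma exp_alpha_mutual_info_eq:
  assumes "0 \<le> \<rho>" "\<rho> < 1"
  shows "exp_alpha_mutual_info \<rho> P N K = mean_norm \<rho>"
proof (cases "\<rho> = 0")
  case True
  then show ?thesis
    using nn_integral_cong_AE[OF AE_nn_integral_f_eq_1]
    by (simp add: exp_alpha_mutual_info_def mean_norm_def PY.emeasure_space_1[unfolded space_PY])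
next
  case False
  define \<alpha> where "\<alpha> = 1 / (1 - \<rho>)"
  have \<alpha>: "1 / \<alpha> = 1 - \<rho>" "\<rho> * (\<alpha> / (\<alpha> - 1)) = 1"
    using assms False by (auto simp: \<alpha>_def field_simps)
  let ?g = "\<lambda>z. exp_ext (ereal \<alpha> * info_density P N K z)"
  let ?c = "nn_cond_exp Q (vimage_algebra (space Q) snd N) ?g"
  have g: "?g z = powr_ext (f z) \<alpha>" for z
    by (simp add: powr_ext_def info_density_def)
  have meas: "?g \<in> borel_measurable (P \<Otimes>\<^sub>M N)" unfolding g by measurable
  have "exp_alpha_mutual_info \<rho> P N K = exp_ext (ereal \<rho> * (ereal (\<alpha> / (\<alpha> - 1))
      * ln_ext (\<integral>\<^sup>+z. powr_ext (?c z) (1 / \<alpha>) \<partial>Q)))"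
    using False by (simp add: exp_alpha_mutual_info_def alpha_mutual_info_def Let_def \<alpha>_def)
  also have "\<dots> = (\<integral>\<^sup>+z. powr_ext (?c z) (1 / \<alpha>) \<partial>Q)"
    \<comment> \<open>The two real factors are merged first, so the possibly infinite logarithm is
      multiplied by exactly 1.\<close>
    by (simp only: mult.assoc[symmetric] times_ereal.simps \<alpha>(2)) (simp flip: one_ereal_def)
  also have "\<dots> = (\<integral>\<^sup>+z. powr_ext (\<integral>\<^sup>+x. ?g (x, snd z) \<partial>P) (1 / \<alpha>) \<partial>Q)"
    by (intro nn_integral_cong_AE AE_mp[OF AE_nn_cond_exp_snd[OF meas] AE_I2]) simp
  also have "\<dots> = (\<integral>\<^sup>+z. powr_ext (\<integral>\<^sup>+x. powr_ext (f (x, snd z)) \<alpha> \<partial>P) (1 - \<rho>) \<partial>Q)"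
    by (simp only: g \<alpha>(1))
  also have "\<dots> = (\<integral>\<^sup>+y. \<integral>\<^sup>+x'. powr_ext (\<integral>\<^sup>+x. powr_ext (f (x, y)) \<alpha> \<partial>P) (1 - \<rho>) \<partial>P \<partial>PY)"
    by (subst Q.nn_integral_snd[of "\<lambda>z. powr_ext (\<integral>\<^sup>+x. powr_ext (f (x, snd z)) \<alpha> \<partial>P) (1 - \<rho>)",
          simplified, symmetric]) auto
  also have "\<dots> = mean_norm \<rho>"
    by (simp add: mean_norm_def \<alpha>_def P.emeasure_space_1)
  finally show ?thesis .
qed

lemma scaled_mean_norm_eq:
  "ennreal (m powr (- \<rho>)) * mean_norm \<rho> = (\<integral>\<^sup>+y. ennreal (m powr (- \<rho>))
     * powr_ext (\<integral>\<^sup>+x. powr_ext (f (x, y)) (1 / (1 - \<rho>)) \<partial>P) (1 - \<rho>) \<partial>PY)"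
  unfolding mean_norm_def by (rule nn_integral_cmult[symmetric]) measurable

text \<open>The norms may be infinite, so dominated convergence is not at hand. Fatou in x leaves an
  inequality inside the outer power, \<open>liminf_scaled_powr_ext\<close> carries it through the
  varying exponent, and Fatou in y finishes.\<close>

lemma liminf_scaled_mean_norm:
  assumes \<rho>: "\<rho> \<longlonglongrightarrow> l" and l: "l < 1" and m: "0 < m"
  shows "ennreal (m powr (- l)) * mean_norm l \<le> liminf (\<lambda>n. ennreal (m powr (- \<rho> n)) * mean_norm (\<rho> n))"
proof -
  let ?I = "\<lambda>\<rho> y. \<integral>\<^sup>+x. powr_ext (f (x, y)) (1 / (1 - \<rho>)) \<partial>P"
  have inner: "?I l y \<le> liminf (\<lambda>n. ?I (\<rho> n) y)" if y: "y \<in> space N" for y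
  proof -
    have [measurable]: "(\<lambda>x. f (x, y)) \<in> borel_measurable P"
      by (rule measurable_Pair2'[THEN measurable_compose, OF _ f_measurable]) (fact y)
    have "(\<lambda>n. 1 / (1 - \<rho> n)) \<longlonglongrightarrow> 1 / (1 - l)"
      using l by (intro tendsto_intros \<rho>) auto
    then have "(\<lambda>n. powr_ext (f (x, y)) (1 / (1 - \<rho> n))) \<longlonglongrightarrow> powr_ext (f (x, y)) (1 / (1 - l))" for x
      using l by (intro tendsto_powr_ext) auto
    then have "?I l y = (\<integral>\<^sup>+x. liminf (\<lambda>n. powr_ext (f (x, y)) (1 / (1 - \<rho> n))) \<partial>P)"
      by (intro nn_integral_cong lim_imp_Liminf[symmetric]) auto
    also have "\<dots> \<le> liminf (\<lambda>n. ?I (\<rho> n) y)"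
      by (rule nn_integral_liminf) measurable
    finally show ?thesis .
  qed
  have "ennreal (m powr (- l)) * mean_norm l
      \<le> (\<integral>\<^sup>+y. liminf (\<lambda>n. ennreal (m powr (- \<rho> n)) * powr_ext (?I (\<rho> n) y) (1 - \<rho> n)) \<partial>PY)"
    unfolding scaled_mean_norm_eq
    by (intro nn_integral_mono liminf_scaled_powr_ext inner \<rho> l m) simp
  also have "\<dots> \<le> liminf (\<lambda>n. ennreal (m powr (- \<rho> n)) * mean_norm (\<rho> n))"
    unfolding scaled_mean_norm_eq by (rule nn_integral_liminf) measurable
  finally show ?thesis .
qed

section \<open>From random codebooks to i.i.d. averages\<close>

text \<open>A uniform mixture of measures with densities has the averaged density, and uniqueness of
  the Radon-Nikodym derivative identifies the two.\<close>

lemma RN_deriv_induced_output: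
  assumes M: "M \<ge> 1" and c: "\<And>k. k \<in> {1..M} \<Longrightarrow> c k \<in> space P"
    and Kc: "\<And>k. k \<in> {1..M} \<Longrightarrow> K (c k) = density PY (\<lambda>y. f (c k, y))"
  shows "AE y in PY. RN_deriv PY (induced_output N K M c) y = ennreal (1 / real M) * (\<Sum>k=1..M. f (c k, y))"
proof -
  have [measurable]: "(\<lambda>y. f (c k, y)) \<in> borel_measurable N" if "k \<in> {1..M}" for k
    by (rule measurable_Pair1'[THEN measurable_compose, OF c[OF that] f_measurable])
  let ?h = "\<lambda>y. ennreal (1 / real M) * (\<Sum>k=1..M. f (c k, y))"
  have "density PY ?h = induced_output N K M c"
  proof (rule measure_eqI)
    fix B assume "B \<in> sets (density PY ?h)"
    then have B [measurable]: "B \<in> sets N" by simp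
    have "emeasure (density PY ?h) B = (\<integral>\<^sup>+y. ?h y * indicator B y \<partial>PY)"
      by (rule emeasure_density) auto
    also have "\<dots> = (\<integral>\<^sup>+y. ennreal (1 / real M) * (\<Sum>k=1..M. f (c k, y) * indicator B y) \<partial>PY)"
      by (simp add: sum_distrib_right mult.assoc)
    also have "\<dots> = ennreal (1 / real M) * (\<Sum>k=1..M. \<integral>\<^sup>+y. f (c k, y) * indicator B y \<partial>PY)"
      by (subst nn_integral_cmult, simp, subst nn_integral_sum) auto
    also have "\<dots> = ennreal (1 / real M) * (\<Sum>k=1..M. emeasure (K (c k)) B)"
      by (intro arg_cong2[where f = "(*)"] sum.cong refl) (simp add: Kc emeasure_density)
    also have "\<dots> = emeasure (induced_output N K M c) B"
      by (rule emeasure_induced_output[OF K c B, symmetric])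
    finally show "emeasure (density PY ?h) B = emeasure (induced_output N K M c) B" .
  qed (simp add: induced_output_def)
  then have "AE y in PY. ?h y = RN_deriv PY (induced_output N K M c) y"
    by (intro PY.RN_deriv_unique) auto
  then show ?thesis by eventually_elim simp
qed

text \<open>Here the conditional density identity enters: it turns the random output distribution
  into an average of \<open>f\<close> at the codewords, whose excess over 1 can be averaged over the
  codebook at fixed y.\<close>

lemma expected_tv_dist_le:
  fixes X :: "nat \<Rightarrow> 'w \<Rightarrow> 'a"
  assumes dens: "cond_density_exp_info P N K" and M: "M \<ge> 1"
    and \<Omega>: "prob_space \<Omega>" and indep: "prob_space.indep_vars \<Omega> (\<lambda>_. P) X {1..M}"
    and ident: "\<And>k. k \<in> {1..M} \<Longrightarrow> distr \<Omega> P (X k) = P"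
    and \<rho>: "0 \<le> \<rho>" "\<rho> \<le> 1/2"
  shows "(\<integral>\<^sup>+\<omega>. ennreal (tv_dist (induced_output N K M (\<lambda>k. X k \<omega>)) PY) \<partial>\<Omega>)
    \<le> ennreal (3/2) * (ennreal (real M powr (- \<rho>)) * mean_norm \<rho>)"
proof -
  interpret \<Omega>: prob_space \<Omega> by fact
  interpret \<Omega>Y: pair_prob_space \<Omega> PY ..
  have rv [measurable]: "X k \<in> \<Omega> \<rightarrow>\<^sub>M P" if "k \<in> {1..M}" for k
    using indep that by (simp add: \<Omega>.indep_vars_def)
  let ?h = "\<lambda>\<omega> y. ennreal (1 / real M) * (\<Sum>k=1..M. f (X k \<omega>, y))"
  \<comment> \<open>Each codeword has law \<open>P\<close>, so it almost surely avoids the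
    \<open>P\<close>-null set where the density identity fails; finitely many codewords do so
    simultaneously.\<close>
  have "AE \<omega> in \<Omega>. \<forall>k\<in>{1..M}. K (X k \<omega>) = density PY (\<lambda>y. f (X k \<omega>, y))"
  proof (rule AE_finite_allI)
    fix k assume k: "k \<in> {1..M}"
    have "AE x in P. K x = density PY (\<lambda>y. f (x, y))"
      using dens by (simp add: cond_density_exp_info_def info_density_def)
    then show "AE \<omega> in \<Omega>. K (X k \<omega>) = density PY (\<lambda>y. f (X k \<omega>, y))"
      by (intro AE_distrD[OF rv[OF k]]) (subst ident[OF k])
  qed simp
  then have "AE \<omega> in \<Omega>. ennreal (tv_dist (induced_output N K M (\<lambda>k. X k \<omega>)) PY) \<le> (\<integral>\<^sup>+y. ?h \<omega> y - 1 \<partial>PY)"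
  proof (rule AE_mp[OF _ AE_I2], intro impI)
    fix \<omega> assume \<omega>: "\<omega> \<in> space \<Omega>" and eq: "\<forall>k\<in>{1..M}. K (X k \<omega>) = density PY (\<lambda>y. f (X k \<omega>, y))"
    have "AE y in PY. RN_deriv PY (induced_output N K M (\<lambda>k. X k \<omega>)) y = ?h \<omega> y"
      using M eq measurable_space[OF rv \<omega>] by (intro RN_deriv_induced_output) auto
    then have "(\<integral>\<^sup>+y. RN_deriv PY (induced_output N K M (\<lambda>k. X k \<omega>)) y - 1 \<partial>PY) = (\<integral>\<^sup>+y. ?h \<omega> y - 1 \<partial>PY)"
      by (intro nn_integral_cong_AE) auto
    then show "ennreal (tv_dist (induced_output N K M (\<lambda>k. X k \<omega>)) PY) \<le> (\<integral>\<^sup>+y. ?h \<omega> y - 1 \<partial>PY)"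
      using ennreal_tv_dist_le[of "induced_output N K M (\<lambda>k. X k \<omega>)" PY] by simp
  qed
  \<comment> \<open>The distance has not been shown measurable in \<omega>; monotonicity of the
    nonnegative integral does not ask for it.\<close>
  then have "(\<integral>\<^sup>+\<omega>. ennreal (tv_dist (induced_output N K M (\<lambda>k. X k \<omega>)) PY) \<partial>\<Omega>)
      \<le> (\<integral>\<^sup>+\<omega>. \<integral>\<^sup>+y. ?h \<omega> y - 1 \<partial>PY \<partial>\<Omega>)"
    by (rule nn_integral_mono_AE)
  also have "\<dots> = (\<integral>\<^sup>+y. \<integral>\<^sup>+\<omega>. ?h \<omega> y - 1 \<partial>\<Omega> \<partial>PY)"
    by (rule \<Omega>Y.Fubini'[symmetric]) measurable
  also have "\<dots> \<le> (\<integral>\<^sup>+y. ennreal (3/2) * (ennreal (real M powr (- \<rho>))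
      * powr_ext (\<integral>\<^sup>+x. powr_ext (f (x, y)) (1 / (1 - \<rho>)) \<partial>P) (1 - \<rho>)) \<partial>PY)"
  proof (rule nn_integral_mono_AE, rule AE_mp[OF AE_nn_integral_f_eq_1 AE_I2], intro impI)
    fix y assume y: "y \<in> space PY" and one: "(\<integral>\<^sup>+x. f (x, y) \<partial>P) = 1"
    have "(\<lambda>x. f (x, y)) \<in> borel_measurable P"
      by (rule measurable_Pair2'[THEN measurable_compose, OF _ f_measurable]) (use y in simp)
    then show "(\<integral>\<^sup>+\<omega>. ?h \<omega> y - 1 \<partial>\<Omega>) \<le> ennreal (3/2) * (ennreal (real M powr (- \<rho>))
      * powr_ext (\<integral>\<^sup>+x. powr_ext (f (x, y)) (1 / (1 - \<rho>)) \<partial>P) (1 - \<rho>))"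
      by (intro \<Omega>.nn_integral_excess_iid_average_le M indep ident one \<rho>)
  qed
  also have "\<dots> = ennreal (3/2) * (ennreal (real M powr (- \<rho>)) * mean_norm \<rho>)"
    unfolding scaled_mean_norm_eq by (rule nn_integral_cmult) measurable
  finally show ?thesis .
qed

end

theorem theorem1:
  fixes P :: "'a measure" and N :: "'b measure" and K :: "'a \<Rightarrow> 'b measure"
    and \<Omega> :: "'w measure" and X :: "nat \<Rightarrow> 'w \<Rightarrow> 'a" and M :: nat
  assumes P: "prob_space P"
    and K: "K \<in> P \<rightarrow>\<^sub>M prob_algebra N"
    and ac: "absolutely_continuous (P \<Otimes>\<^sub>M output_dist P N K) (joint_dist P N K)"
    and dens: "cond_density_exp_info P N K"
    and M: "M \<ge> 1"
    and \<Omega>: "prob_space \<Omega>"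
    and indep: "prob_space.indep_vars \<Omega> (\<lambda>_. P) X {1..M}"
    and ident: "\<And>k. k \<in> {1..M} \<Longrightarrow> distr \<Omega> P (X k) = P"
  shows "\<exists>\<rho>\<^sub>0\<in>{0..1/2}.
           (\<forall>\<rho>\<in>{0..1/2}. ennreal (real M powr (-\<rho>\<^sub>0)) * exp_alpha_mutual_info \<rho>\<^sub>0 P N K
                        \<le> ennreal (real M powr (-\<rho>)) * exp_alpha_mutual_info \<rho> P N K) \<and>
           (\<integral>\<^sup>+\<omega>. ennreal (tv_dist (induced_output N K M (\<lambda>k. X k \<omega>)) (output_dist P N K)) \<partial>\<Omega>)
             \<le> ennreal (3/2) * (ennreal (real M powr (-\<rho>\<^sub>0)) * exp_alpha_mutual_info \<rho>\<^sub>0 P N K)"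
proof -
  interpret abs_cont_channel P N K
    using P K ac by (simp add: abs_cont_channel_def abs_cont_channel_axioms_def)
  \<comment> \<open>The interval is compact, its points are below 1, and M \<ge> 1 makes the base
    positive, so \<open>liminf_scaled_mean_norm\<close> gives semicontinuity on all of it; infinite
    values do no harm.\<close>
  have "\<exists>\<rho>\<^sub>0\<in>{0..1/2}. \<forall>\<rho>\<in>{0..1/2}.
      ennreal (real M powr (-\<rho>\<^sub>0)) * mean_norm \<rho>\<^sub>0 \<le> ennreal (real M powr (-\<rho>)) * mean_norm \<rho>"
    by (rule compact_attains_Inf_of_liminf_le[of "{0..1/2::real}"])
       (use M in \<open>auto intro!: liminf_scaled_mean_norm\<close>)
  then obtain \<rho>\<^sub>0 where \<rho>\<^sub>0: "\<rho>\<^sub>0 \<in> {0..1/2}"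
    "\<And>\<rho>. \<rho> \<in> {0..1/2} \<Longrightarrow>
      ennreal (real M powr (-\<rho>\<^sub>0)) * mean_norm \<rho>\<^sub>0 \<le> ennreal (real M powr (-\<rho>)) * mean_norm \<rho>"
    by blast
  have eq: "exp_alpha_mutual_info \<rho> P N K = mean_norm \<rho>" if "\<rho> \<in> {0..1/2}" for \<rho>
    using that by (intro exp_alpha_mutual_info_eq) auto
  \<comment> \<open>The estimate holds at every \<rho> in the interval, in particular at the
    minimizer.\<close>
  show ?thesis
    using \<rho>\<^sub>0 expected_tv_dist_le[OF dens M \<Omega> indep ident, of \<rho>\<^sub>0]
    by (intro bexI[of _ \<rho>\<^sub>0] conjI ballI) (simp_all add: eq)
qed

end
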